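(* Let $\lambda>0$, $y_1\ge y_0>0$, $s\in\mathbb R$ and $l\in\mathbb N$ with $l\ge2$. Let $g:(0,\infty)\to\mathbb R$ be of class $\mathcal C^l$ and assume that $\sum_{p=2}^{l}|g^{(p)}|\ge\lambda$ on $[\tfrac12y_0,2y_1]$. Then there exists $C>0$ such that for any $k\in\mathbb Z$ with $y_0\le2^k\le y_1$, any $\delta>0$ and any $t\in\mathbb R\setminus\{0\}$, $$\sup_{x\in\mathbb R}|I^{s}_{t,x,k}|\le C\,\frac{\delta^{-(s+1-\frac1l)}}{|t|^{\frac1l}},$$ and $$\sup_{x\in\mathbb R}\Big|\int_{\mathbb R}e^{ix\xi}e^{i\frac t\delta g(\delta|\xi|)}\sum_{k\in\mathbb Z,\ y_0\le2^k\le y_1}Q_k(\delta\xi)|\xi|^{s}\,d\xi\Big|\le C\,\frac{\delta^{-(s+1-\frac1l)}}{|t|^{\frac1l}}.$$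
   Context: Dimension $n=1$. $P$ is a fixed smooth even function on $\mathbb R$ supported in $\{\tfrac12\le|y|\le 2\}$, and $$I^{s}_{t,x,k}:=\int_0^{\infty}e^{ix\xi}e^{i\frac t\delta g(\delta\xi)}P\big(\tfrac{\delta\xi}{2^k}\big)\xi^{s}\,d\xi .$$ Littlewood-Paley functions: $\varphi_0$ is a fixed smooth nonnegative even function supported in $[-\tfrac45,\tfrac45]$, equal to $1$ on $[-\tfrac35,\tfrac35]$ and nonincreasing on $[0,\infty)$; $Q_j(y):=\varphi_0(2^{-j-1}y)-\varphi_0(2^{-j}y)$ for $j\in\mathbb Z$. The constant $C$ does not depend on $t,\delta,k,x$. *)

theory Defs
  imports "HOL-Analysis.Analysis"
begin

definition nth_deriv :: "nat \<Rightarrow> (real \<Rightarrow> 'a::real_normed_vector) \<Rightarrow> real \<Rightarrow> 'a" where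
  "nth_deriv n f = ((\<lambda>h x. vector_derivative h (at x)) ^^ n) f"

(* Intended for open S: the derivatives are two-sided, so on an open set they depend only on
   the values of f on S. *)
definition C_on :: "nat \<Rightarrow> (real \<Rightarrow> 'a::real_normed_vector) \<Rightarrow> real set \<Rightarrow> bool" where
  "C_on n f S \<longleftrightarrow>
     (\<forall>p<n. \<forall>x\<in>S. nth_deriv p f differentiable at x) \<and> continuous_on S (nth_deriv n f)"

definition smooth :: "(real \<Rightarrow> 'a::real_normed_vector) \<Rightarrow> bool" where
  "smooth f \<longleftrightarrow> (\<forall>n. C_on n f UNIV)"

definition supp :: "(real \<Rightarrow> 'a::real_normed_vector) \<Rightarrow> real set" where
  "supp f = closure {y. f y \<noteq> 0}"

definition even_fun :: "(real \<Rightarrow> 'a) \<Rightarrow> bool" where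
  "even_fun f \<longleftrightarrow> (\<forall>y. f (- y) = f y)"

(* Scalar functions on the real line are complex-valued unless a sign or monotonicity
   condition forces them to be real; this includes the real-valued case. *)
definition annular_cutoff :: "(real \<Rightarrow> complex) \<Rightarrow> bool" where
  "annular_cutoff P \<longleftrightarrow>
     smooth P \<and> even_fun P \<and> supp P \<subseteq> {y. 1/2 \<le> \<bar>y\<bar> \<and> \<bar>y\<bar> \<le> 2}"

definition lp_generator :: "(real \<Rightarrow> real) \<Rightarrow> bool" where
  "lp_generator \<phi>0 \<longleftrightarrow>
     smooth \<phi>0 \<and> (\<forall>y. 0 \<le> \<phi>0 y) \<and> even_fun \<phi>0 \<and>
     supp \<phi>0 \<subseteq> {-4/5..4/5} \<and> (\<forall>y\<in>{-3/5..3/5}. \<phi>0 y = 1) \<and>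
     antimono_on {0..} \<phi>0"

definition lp_Q :: "(real \<Rightarrow> real) \<Rightarrow> int \<Rightarrow> real \<Rightarrow> real" where
  "lp_Q \<phi>0 j y = \<phi>0 (2 powi (- j - 1) * y) - \<phi>0 (2 powi (- j) * y)"

definition osc_I ::
  "(real \<Rightarrow> complex) \<Rightarrow> (real \<Rightarrow> real) \<Rightarrow> real \<Rightarrow> real \<Rightarrow> real \<Rightarrow> real \<Rightarrow> int \<Rightarrow> complex" where
  "osc_I P g s \<delta> t x k =
     (LINT \<xi>:{0<..}|lborel.
        exp (\<i> * of_real (x * \<xi>)) * exp (\<i> * of_real (t / \<delta> * g (\<delta> * \<xi>)))
        * P (\<delta> * \<xi> / 2 powi k) * of_real (\<xi> powr s))"

(* g is only meaningful on the positive half-line; the single point \<xi> = 0 does not matter. *)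
definition osc_J ::
  "(real \<Rightarrow> real) \<Rightarrow> (real \<Rightarrow> real) \<Rightarrow> real \<Rightarrow> real \<Rightarrow> real \<Rightarrow> real \<Rightarrow> real \<Rightarrow> real \<Rightarrow> complex" where
  "osc_J \<phi>0 g s y0 y1 \<delta> t x =
     (LINT \<xi>|lborel.
        exp (\<i> * of_real (x * \<xi>)) * exp (\<i> * of_real (t / \<delta> * g (\<delta> * \<bar>\<xi>\<bar>)))
        * of_real (\<Sum>k\<in>{k::int. y0 \<le> 2 powi k \<and> 2 powi k \<le> y1}. lp_Q \<phi>0 k (\<delta> * \<xi>))
        * of_real (\<bar>\<xi>\<bar> powr s))"

end

theory Submission
  imports Defs
begin

text \<open>
  Substituting \<open>y = \<delta> \<xi>\<close> turns both integrals into \<open>\<delta> powr (- 1 - s)\<close> times integrals of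
  \<open>exp (\<i> (X y + T g y)) a y\<close> with \<open>T = t / \<delta>\<close> and a fixed \<open>C\<^sup>1\<close> amplitude \<open>a\<close> supported in
  \<open>[y0 / 2, 2 y1]\<close>, so it suffices to bound these by \<open>C \<bar>T\<bar> powr (- 1 / l)\<close> uniformly in \<open>X\<close>.
  Near every point of that interval some \<open>g\<^sup>(\<^sup>p\<^sup>)\<close> with \<open>2 \<le> p \<le> l\<close> is bounded away from zero; as
  \<open>p \<ge> 2\<close>, the linear term \<open>X y\<close> does not affect it, and van der Corput's lemma gives the decay
  \<open>\<bar>T\<bar> powr (- 1 / p)\<close>, which is stronger than needed when \<open>\<bar>T\<bar> \<ge> 1\<close>. For \<open>\<bar>T\<bar> < 1\<close> the trivial bound
  suffices. Compactness gives a uniform constant, and one integration by parts inserts the amplitude.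
\<close>

section \<open>Van der Corput's lemma\<close>

lemma cis_has_vector_derivative:
  assumes "(f has_real_derivative f') (at x within S)"
  shows "((\<lambda>x. cis (f x)) has_vector_derivative \<i> * of_real f' * cis (f x)) (at x within S)"
proof -
  have "(f has_derivative (\<lambda>h. h *\<^sub>R f')) (at x within S)"
    using assms by (simp add: has_real_derivative_iff_has_vector_derivative has_vector_derivative_def)
  then show ?thesis
    unfolding has_vector_derivative_def
    by (auto intro!: derivative_eq_intros simp: scaleR_conv_of_real mult_ac)
qed

text \<open>Integration by parts after writing \<open>cis (\<phi> x)\<close> as
  \<open>1 / (\<i> * \<phi>' x)\<close> times the derivative of \<open>cis (\<phi> x)\<close>. The
  two boundary terms are at most \<open>1 / \<epsilon>\<close> each. The remaining integrand has
  modulus \<open>\<bar>\<phi>'' x\<bar> / (\<phi>' x)\<^sup>2\<close>; as \<open>\<phi>''\<close>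
  keeps its sign, this is up to sign the derivative of \<open>1 / \<phi>'\<close>, so its integral
  contributes only another \<open>2 / \<epsilon>\<close>, however long the interval. The factor
  \<open>\<sigma>\<close>, which is 1 or -1, treats both signs at once.\<close>

lemma first_derivative_test:
  fixes \<phi> \<phi>' \<phi>'' :: "real \<Rightarrow> real"
  assumes ab: "a \<le> b"
    and d1: "\<And>x. x \<in> {a..b} \<Longrightarrow> (\<phi> has_real_derivative \<phi>' x) (at x within {a..b})"
    and d2: "\<And>x. x \<in> {a..b} \<Longrightarrow> (\<phi>' has_real_derivative \<phi>'' x) (at x within {a..b})"
    and cont: "continuous_on {a..b} \<phi>''"
    and sgn: "\<And>x. x \<in> {a..b} \<Longrightarrow> 0 \<le> \<sigma> * \<phi>'' x" and \<sigma>: "\<bar>\<sigma>\<bar> = 1"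
    and \<epsilon>: "0 < \<epsilon>" and big: "\<And>x. x \<in> {a..b} \<Longrightarrow> \<epsilon> \<le> \<bar>\<phi>' x\<bar>"
  shows "cmod (integral {a..b} (\<lambda>x. cis (\<phi> x))) \<le> 4 / \<epsilon>"
proof -
  have nz: "\<phi>' x \<noteq> 0" if "x \<in> {a..b}" for x
    using big[OF that] \<epsilon> by auto
  have c0: "continuous_on {a..b} \<phi>" and c1: "continuous_on {a..b} \<phi>'"
    by (rule DERIV_continuous_on, erule d1, rule DERIV_continuous_on, erule d2)
  have inv_le: "\<bar>1 / \<phi>' x\<bar> \<le> 1 / \<epsilon>" if "x \<in> {a..b}" for x
    using big[OF that] \<epsilon> by (simp add: frac_le)
  \<comment> \<open>\<open>G\<close> is the boundary term of the integration by parts and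
    \<open>R\<close> the correction: the derivative of \<open>G\<close> is
    \<open>cis (\<phi> x) - R x\<close>.\<close>
  define G where "G = (\<lambda>x. cis (\<phi> x) * of_real (1 / \<phi>' x) * (1 / \<i>))"
  define R where "R = (\<lambda>x. cis (\<phi> x) * of_real (\<phi>'' x / (\<phi>' x)\<^sup>2) * (1 / \<i>))"
  have cR: "continuous_on {a..b} R"
    unfolding R_def using nz by (intro continuous_intros c0 c1 cont) auto
  have dG: "(G has_vector_derivative cis (\<phi> x) - R x) (at x within {a..b})" if x: "x \<in> {a..b}" for x
  proof -
    have "((\<lambda>x. 1 / \<phi>' x) has_real_derivative - (\<phi>'' x / (\<phi>' x)\<^sup>2)) (at x within {a..b})"
      using DERIV_inverse_fun[OF d2[OF x] nz[OF x]]
      by (simp add: field_simps power2_eq_square)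
    then have 1: "((\<lambda>x. complex_of_real (1 / \<phi>' x)) has_vector_derivative
        of_real (- (\<phi>'' x / (\<phi>' x)\<^sup>2))) (at x within {a..b})"
      by (rule has_vector_derivative_of_real)
    have alg: "(z * - q + \<i> * z) * (1 / \<i>) = z - z * q * (1 / \<i>)" for z q :: complex
      by (simp add: field_simps)
    have "(G has_vector_derivative
       (cis (\<phi> x) * of_real (- (\<phi>'' x / (\<phi>' x)\<^sup>2)) +
         (\<i> * of_real (\<phi>' x) * cis (\<phi> x)) * of_real (1 / \<phi>' x)) * (1 / \<i>)) (at x within {a..b})"
      unfolding G_def
      by (intro has_vector_derivative_mult has_vector_derivative_mult_left cis_has_vector_derivative d1 x 1)
    moreover have "(\<i> * of_real (\<phi>' x) * cis (\<phi> x)) * of_real (1 / \<phi>' x) = \<i> * cis (\<phi> x)"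
      using nz[OF x] by simp
    then have "(cis (\<phi> x) * of_real (- (\<phi>'' x / (\<phi>' x)\<^sup>2)) +
         (\<i> * of_real (\<phi>' x) * cis (\<phi> x)) * of_real (1 / \<phi>' x)) * (1 / \<i>) = cis (\<phi> x) - R x"
      using alg by (simp only: R_def of_real_minus)
    ultimately show ?thesis by simp
  qed
  have "((\<lambda>x. cis (\<phi> x) - R x) has_integral (G b - G a)) {a..b}"
    by (intro fundamental_theorem_of_calculus ab dG)
  moreover have "(R has_integral (integral {a..b} R)) {a..b}"
    using cR by (intro integrable_integral integrable_continuous_real)
  ultimately have "((\<lambda>x. cis (\<phi> x) - R x + R x) has_integral (G b - G a + integral {a..b} R)) {a..b}"
    by (rule has_integral_add)
  then have eq: "integral {a..b} (\<lambda>x. cis (\<phi> x)) = G b - G a + integral {a..b} R"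
    by (simp add: integral_unique)
  \<comment> \<open>Since \<open>\<sigma> * \<phi>'' x\<close> equals
    \<open>\<bar>\<phi>'' x\<bar>\<close>, \<open>H\<close> is a primitive of the modulus of
    \<open>R\<close>.\<close>
  define H where "H = (\<lambda>x. - \<sigma> / \<phi>' x)"
  have "(H has_real_derivative \<sigma> * \<phi>'' x / (\<phi>' x)\<^sup>2) (at x within {a..b})" if x: "x \<in> {a..b}" for x
    using DERIV_cmult[OF DERIV_inverse_fun[OF d2[OF x] nz[OF x]], of "- \<sigma>"]
    by (simp add: H_def field_simps power2_eq_square)
  then have dH: "((\<lambda>x. \<sigma> * \<phi>'' x / (\<phi>' x)\<^sup>2) has_integral (H b - H a)) {a..b}"
    by (intro fundamental_theorem_of_calculus ab)
      (simp only: has_real_derivative_iff_has_vector_derivative)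
  have "cmod (integral {a..b} R) \<le> integral {a..b} (\<lambda>x. \<sigma> * \<phi>'' x / (\<phi>' x)\<^sup>2)"
  proof (rule Henstock_Kurzweil_Integration.integral_norm_bound_integral)
    show "R integrable_on {a..b}" using cR by (rule integrable_continuous_real)
    show "(\<lambda>x. \<sigma> * \<phi>'' x / (\<phi>' x)\<^sup>2) integrable_on {a..b}" using dH by blast
    fix x assume x: "x \<in> {a..b}"
    have "\<bar>\<phi>'' x\<bar> = \<bar>\<sigma> * \<phi>'' x\<bar>" using \<sigma> by (simp add: abs_mult)
    also have "\<dots> = \<sigma> * \<phi>'' x" using sgn[OF x] by simp
    finally have "\<bar>\<phi>'' x\<bar> = \<sigma> * \<phi>'' x" .
    then show "cmod (R x) \<le> \<sigma> * \<phi>'' x / (\<phi>' x)\<^sup>2"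
      by (simp add: R_def norm_mult norm_divide norm_power)
  qed
  also have "\<dots> = H b - H a" using dH by (rule integral_unique)
  also have "\<dots> \<le> \<bar>H b\<bar> + \<bar>H a\<bar>" by linarith
  also have "\<dots> \<le> 1 / \<epsilon> + 1 / \<epsilon>"
    using inv_le[of a] inv_le[of b] ab \<sigma> by (intro add_mono) (simp_all add: H_def abs_divide)
  finally have "cmod (integral {a..b} R) \<le> 1 / \<epsilon> + 1 / \<epsilon>" .
  moreover have "cmod (G x) \<le> 1 / \<epsilon>" if "x \<in> {a..b}" for x
    using inv_le[OF that] by (simp add: G_def norm_mult norm_divide)
  then have "cmod (G b) \<le> 1 / \<epsilon>" "cmod (G a) \<le> 1 / \<epsilon>" using ab by auto
  moreover have "cmod (G b - G a + integral {a..b} R) \<le> cmod (G b) + cmod (G a) + cmod (integral {a..b} R)"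
    by (intro order_trans[OF norm_triangle_ineq] add_right_mono norm_triangle_ineq4)
  ultimately show ?thesis unfolding eq by (simp add: divide_inverse)
qed

text \<open>As \<open>f\<close> grows at rate at least \<open>\<mu>\<close>, the set where
  \<open>\<bar>f x\<bar> < \<epsilon>\<close> lies in a window of length
  \<open>2 * \<epsilon> / \<mu>\<close>. There \<open>e\<close> is estimated by 1; on each of the at
  most two remaining intervals \<open>bound\<close> gives \<open>M\<close>. Leaving \<open>e\<close>
  and \<open>M\<close> abstract lets the same splitting serve the base case and the induction step
  of van der Corput's lemma.\<close>

lemma integral_split_at_small_values:
  fixes f :: "real \<Rightarrow> real" and e :: "real \<Rightarrow> complex"
  assumes ab: "a \<le> b" and cf: "continuous_on {a..b} f"
    and lam: "0 < \<mu>" and \<epsilon>: "0 < \<epsilon>" and M: "0 \<le> M"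
    and slope: "\<And>x y. a \<le> x \<Longrightarrow> x \<le> y \<Longrightarrow> y \<le> b \<Longrightarrow> \<mu> * (y - x) \<le> f y - f x"
    and ce: "continuous_on {a..b} e" and ne: "\<And>x. x \<in> {a..b} \<Longrightarrow> cmod (e x) \<le> 1"
    and bound: "\<And>u v. a \<le> u \<Longrightarrow> u \<le> v \<Longrightarrow> v \<le> b \<Longrightarrow> (\<And>x. x \<in> {u..v} \<Longrightarrow> \<epsilon> \<le> \<bar>f x\<bar>)
                  \<Longrightarrow> cmod (integral {u..v} e) \<le> M"
  shows "cmod (integral {a..b} e) \<le> 2 * M + 2 * \<epsilon> / \<mu>"
proof -
  \<comment> \<open>The centre \<open>z\<close> of the window is a zero of \<open>f\<close> or, if
    \<open>f\<close> does not change sign, the endpoint at which \<open>\<bar>f\<bar>\<close> is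
    smallest.\<close>
  have "\<exists>z\<in>{a..b}. \<forall>x\<in>{a..b}. \<mu> * \<bar>x - z\<bar> \<le> \<bar>f x\<bar>"
  proof -
    consider "0 \<le> f a" | "f b \<le> 0" | "f a \<le> 0" "0 \<le> f b" by linarith
    then show ?thesis
    proof cases
      case 1
      have "\<mu> * \<bar>x - a\<bar> \<le> \<bar>f x\<bar>" if "x \<in> {a..b}" for x
        using slope[of a x] 1 that by auto
      then show ?thesis using ab by (intro bexI[of _ a]) auto
    next
      case 2
      have "\<mu> * \<bar>x - b\<bar> \<le> \<bar>f x\<bar>" if "x \<in> {a..b}" for x
        using slope[of x b] 2 that by auto
      then show ?thesis using ab by (intro bexI[of _ b]) auto
    next
      case 3
      then obtain z where z: "a \<le> z" "z \<le> b" "f z = 0"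
        using IVT'[of f a 0 b] ab cf by blast
      have "\<mu> * \<bar>x - z\<bar> \<le> \<bar>f x\<bar>" if "x \<in> {a..b}" for x
        using slope[of x z] slope[of z x] z that by (cases "x \<le> z") auto
      then show ?thesis using z by (intro bexI[of _ z]) auto
    qed
  qed
  then obtain z where z: "a \<le> z" "z \<le> b" and fz: "\<And>x. x \<in> {a..b} \<Longrightarrow> \<mu> * \<bar>x - z\<bar> \<le> \<bar>f x\<bar>"
    by auto
  define h where "h = \<epsilon> / \<mu>"
  have h: "0 < h" using lam \<epsilon> by (simp add: h_def)
  have far: "\<epsilon> \<le> \<bar>f x\<bar>" if "x \<in> {a..b}" "h \<le> \<bar>x - z\<bar>" for x
  proof -
    have "\<epsilon> = \<mu> * h" using lam by (simp add: h_def)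
    also have "\<dots> \<le> \<mu> * \<bar>x - z\<bar>" using that lam by simp
    finally show ?thesis using fz[OF that(1)] by linarith
  qed
  \<comment> \<open>The window from \<open>z - h\<close> to \<open>z + h\<close> is clipped to
    \<open>{a..b}\<close>. Where clipping occurs, the outer interval degenerates to a point and its
    integral is 0, which is why \<open>0 \<le> M\<close> is assumed.\<close>
  define c where "c = max a (z - h)"
  define d where "d = min b (z + h)"
  have cd: "a \<le> c" "c \<le> d" "d \<le> b" using z h ab by (auto simp: c_def d_def)
  have int: "e integrable_on {u..v}" if "a \<le> u" "v \<le> b" for u v
    using that by (intro integrable_continuous_real continuous_on_subset[OF ce]) auto
  have "integral {a..b} e = integral {a..c} e + integral {c..b} e"
    using cd int by (intro Henstock_Kurzweil_Integration.integral_combine[symmetric]) auto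
  also have "integral {c..b} e = integral {c..d} e + integral {d..b} e"
    using cd int by (intro Henstock_Kurzweil_Integration.integral_combine[symmetric]) auto
  finally have eq: "integral {a..b} e = integral {a..c} e + (integral {c..d} e + integral {d..b} e)" .
  have 1: "cmod (integral {a..c} e) \<le> M"
  proof (cases "c = a")
    case False
    then have "c = z - h" by (auto simp: c_def max_def split: if_splits)
    then show ?thesis using cd by (intro bound far) auto
  qed (use M in simp)
  have 2: "cmod (integral {d..b} e) \<le> M"
  proof (cases "d = b")
    case False
    then have "d = z + h" by (auto simp: d_def min_def split: if_splits)
    then show ?thesis using cd by (intro bound far) auto
  qed (use M in simp)
  have "cmod (integral {c..d} e) \<le> 1 * (d - c)"
    using cd by (intro integral_bound continuous_on_subset[OF ce] ne) auto
  also have "\<dots> \<le> 2 * h" by (auto simp: c_def d_def)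
  finally have "cmod (integral {c..d} e) \<le> 2 * \<epsilon> / \<mu>" by (simp add: h_def)
  then show ?thesis unfolding eq using 1 2
      norm_triangle_ineq[of "integral {a..c} e" "integral {c..d} e + integral {d..b} e"]
      norm_triangle_ineq[of "integral {c..d} e" "integral {d..b} e"] by linarith
qed

text \<open>The image of an interval is connected, so a continuous function that stays away from
  zero cannot change sign. Multiplying by \<open>\<sigma>\<close> then reduces the decreasing case
  to the increasing one.\<close>

lemma constant_sign:
  fixes f :: "real \<Rightarrow> real"
  assumes "continuous_on {a..b} f" "0 < \<mu>" "\<And>x. x \<in> {a..b} \<Longrightarrow> \<mu> \<le> \<bar>f x\<bar>"
  obtains \<sigma> :: real where "\<bar>\<sigma>\<bar> = 1" "\<And>x. x \<in> {a..b} \<Longrightarrow> \<mu> \<le> \<sigma> * f x"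
proof -
  have "(\<forall>x\<in>{a..b}. \<mu> \<le> f x) \<or> (\<forall>x\<in>{a..b}. \<mu> \<le> - f x)"
  proof (rule ccontr)
    assume "\<not> ?thesis"
    then obtain x y where xy: "x \<in> {a..b}" "y \<in> {a..b}" "f x < \<mu>" "- f y < \<mu>"
      by (auto simp: not_le)
    then have "f x \<le> 0" "0 \<le> f y" using assms(3)[of x] assms(3)[of y] by auto
    moreover have "connected (f ` {a..b})"
      using assms(1) by (intro connected_continuous_image) auto
    ultimately have "0 \<in> f ` {a..b}"
      using xy by (meson connectedD_interval imageI)
    then show False using assms(2,3) by fastforce
  qed
  then show ?thesis using that[of 1] that[of "-1"] by auto
qed

lemma slope_bound:
  fixes f :: "real \<Rightarrow> real"
  assumes d: "\<And>x. x \<in> {a..b} \<Longrightarrow> (f has_real_derivative f' x) (at x within {a..b})"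
    and le: "\<And>x. x \<in> {a..b} \<Longrightarrow> \<mu> \<le> f' x" and xy: "a \<le> x" "x \<le> y" "y \<le> b"
  shows "\<mu> * (y - x) \<le> f y - f x"
proof -
  have "f x - \<mu> * x \<le> f y - \<mu> * y"
  proof (rule DERIV_nonneg_imp_increasing_open[OF \<open>x \<le> y\<close>])
    have "continuous_on {a..b} f" using d by (rule DERIV_continuous_on)
    then show "continuous_on {x..y} (\<lambda>z. f z - \<mu> * z)"
      using xy by (intro continuous_intros) (auto elim: continuous_on_subset)
    fix z assume z: "x < z" "z < y"
    then have "(f has_real_derivative f' z) (at z)"
      using d[of z] xy by (simp add: at_within_Icc_at)
    then have "((\<lambda>z. f z - \<mu> * z) has_real_derivative f' z - \<mu>) (at z)"
      by (auto intro!: derivative_eq_intros)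
    then show "\<exists>D. ((\<lambda>z. f z - \<mu> * z) has_real_derivative D) (at z) \<and> 0 \<le> D"
      using le[of z] z xy by (intro exI[of _ "f' z - \<mu>"]) auto
  qed
  then show ?thesis by (simp add: algebra_simps)
qed

text \<open>The constants \<open>c\<^sub>p = 3 * 2 ^ p - 2\<close> solve \<open>c\<^sub>p\<^sub>+\<^sub>1 = 2 c\<^sub>p + 2\<close>, the recursion obtained by splitting
  at \<open>\<bar>D p\<bar> = \<mu> powr (p / (p + 1))\<close>.\<close>

lemma van_der_Corput:
  fixes D :: "nat \<Rightarrow> real \<Rightarrow> real"
  assumes "2 \<le> p" and ab: "a \<le> b" and "0 < \<mu>"
    and "\<And>i x. i < p \<Longrightarrow> x \<in> {a..b} \<Longrightarrow> (D i has_real_derivative D (Suc i) x) (at x within {a..b})"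
    and "continuous_on {a..b} (D p)"
    and "\<And>x. x \<in> {a..b} \<Longrightarrow> \<mu> \<le> \<bar>D p x\<bar>"
  shows "cmod (integral {a..b} (\<lambda>x. cis (D 0 x))) \<le> (3 * 2 ^ p - 2) * \<mu> powr (- 1 / p)"
  using assms
proof (induction p arbitrary: a b \<mu> rule: nat_induct_at_least)
  case base
  note d = base(3)
  obtain \<sigma> :: real where \<sigma>: "\<bar>\<sigma>\<bar> = 1" "\<And>x. x \<in> {a..b} \<Longrightarrow> \<mu> \<le> \<sigma> * D 2 x"
    using constant_sign[OF base(4) base(2) base(5)] by metis
  have c0: "continuous_on {a..b} (D 0)" and c1: "continuous_on {a..b} (D 1)"
    using DERIV_continuous_on[OF d[of 0]] DERIV_continuous_on[OF d[of 1]] by auto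
  have 2: "Suc (Suc 0) = 2" by simp
  have ds: "((\<lambda>x. \<sigma> * D 1 x) has_real_derivative \<sigma> * D 2 x) (at x within {a..b})" if "x \<in> {a..b}" for x
    using d[of 1, OF _ that] by (auto intro!: derivative_eq_intros simp: 2)
  \<comment> \<open>The splitting is at \<open>\<bar>D 1 x\<bar> = sqrt \<mu>\<close>, which makes
    both contributions multiples of \<open>1 / sqrt \<mu>\<close>. Outside the window the first
    derivative test applies because \<open>D 2\<close> has constant sign. The total
    \<open>8 + 2 = 10\<close> is \<open>3 * 2 ^ 2 - 2\<close>.\<close>
  have "cmod (integral {a..b} (\<lambda>x. cis (D 0 x))) \<le> 2 * (4 / sqrt \<mu>) + 2 * sqrt \<mu> / \<mu>"
  proof (rule integral_split_at_small_values[where f = "\<lambda>x. \<sigma> * D 1 x"])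
    fix x y assume "a \<le> x" "x \<le> y" "y \<le> b"
    then show "\<mu> * (y - x) \<le> \<sigma> * D 1 y - \<sigma> * D 1 x"
      using slope_bound[OF ds \<sigma>(2)] by auto
  next
    fix u v assume uv: "a \<le> u" "u \<le> v" "v \<le> b" and big: "\<And>x. x \<in> {u..v} \<Longrightarrow> sqrt \<mu> \<le> \<bar>\<sigma> * D 1 x\<bar>"
    have sub: "{u..v} \<subseteq> {a..b}" using uv by auto
    show "cmod (integral {u..v} (\<lambda>x. cis (D 0 x))) \<le> 4 / sqrt \<mu>"
    proof (rule first_derivative_test[where \<phi>' = "D 1" and \<phi>'' = "D 2" and \<sigma> = \<sigma>])
      fix x assume x: "x \<in> {u..v}"
      show "(D 0 has_real_derivative D 1 x) (at x within {u..v})"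
        using d[of 0 x] x sub by (auto intro: DERIV_subset)
      show "(D 1 has_real_derivative D 2 x) (at x within {u..v})"
        using d[of 1 x] x sub by (auto intro: DERIV_subset simp: 2)
      show "0 \<le> \<sigma> * D 2 x" using \<sigma>(2)[of x] x sub base(2) by (auto intro: order_trans[of _ \<mu>])
      show "sqrt \<mu> \<le> \<bar>D 1 x\<bar>" using big[OF x] \<sigma>(1) by (simp add: abs_mult)
    qed (use uv \<sigma> base in \<open>auto intro: continuous_on_subset[OF _ sub]\<close>)
  qed (use base c0 c1 in \<open>auto intro!: continuous_intros\<close>)
  also have "\<dots> = 10 / sqrt \<mu>"
    using base(2) by (simp add: field_simps)
  also have "\<dots> = 10 * \<mu> powr (- (1 / 2))"
    using base(2) by (simp only: powr_minus_divide powr_half_sqrt less_imp_le)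
  finally show ?case by simp
next
  case (Suc p)
  note d = Suc(5)
  obtain \<sigma> :: real where \<sigma>: "\<bar>\<sigma>\<bar> = 1" "\<And>x. x \<in> {a..b} \<Longrightarrow> \<mu> \<le> \<sigma> * D (Suc p) x"
    using constant_sign[OF Suc(6) Suc(4) Suc(7)] by metis
  have c0: "continuous_on {a..b} (D 0)" and c1: "continuous_on {a..b} (D p)"
    using DERIV_continuous_on[OF d[of 0]] DERIV_continuous_on[OF d[of p]] by auto
  have ds: "((\<lambda>x. \<sigma> * D p x) has_real_derivative \<sigma> * D (Suc p) x) (at x within {a..b})" if "x \<in> {a..b}" for x
    using d[of p, OF _ that] by (auto intro!: derivative_eq_intros)
  \<comment> \<open>This exponent balances the two contributions:
    \<open>\<epsilon> powr (- 1 / p)\<close> from the induction hypothesis and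
    \<open>\<epsilon> / \<mu>\<close> from the window both equal
    \<open>\<mu> powr (- 1 / Suc p)\<close>.\<close>
  define \<epsilon> where "\<epsilon> = \<mu> powr (p / Suc p)"
  have \<epsilon>: "0 < \<epsilon>" using Suc(4) by (simp add: \<epsilon>_def)
  define K :: real where "K = 3 * 2 ^ p - 2"
  have "(1::real) \<le> 2 ^ p" by simp
  then have K: "0 \<le> K" unfolding K_def by linarith
  have "cmod (integral {a..b} (\<lambda>x. cis (D 0 x))) \<le> 2 * (K * \<epsilon> powr (- 1 / p)) + 2 * \<epsilon> / \<mu>"
  proof (rule integral_split_at_small_values[where f = "\<lambda>x. \<sigma> * D p x"])
    fix x y assume "a \<le> x" "x \<le> y" "y \<le> b"
    then show "\<mu> * (y - x) \<le> \<sigma> * D p y - \<sigma> * D p x"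
      using slope_bound[OF ds \<sigma>(2)] by auto
  next
    fix u v assume uv: "a \<le> u" "u \<le> v" "v \<le> b" and big: "\<And>x. x \<in> {u..v} \<Longrightarrow> \<epsilon> \<le> \<bar>\<sigma> * D p x\<bar>"
    have sub: "{u..v} \<subseteq> {a..b}" using uv by auto
    show "cmod (integral {u..v} (\<lambda>x. cis (D 0 x))) \<le> K * \<epsilon> powr (- 1 / p)"
      unfolding K_def
    proof (rule Suc.IH)
      fix x assume x: "x \<in> {u..v}"
      show "(D i has_real_derivative D (Suc i) x) (at x within {u..v})" if "i < p" for i
        using d[of i x] x sub that by (auto intro: DERIV_subset)
      show "\<epsilon> \<le> \<bar>D p x\<bar>" using big[OF x] \<sigma>(1) by (simp add: abs_mult)
    qed (use uv \<epsilon> c1 in \<open>auto intro: continuous_on_subset[OF _ sub]\<close>)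
  qed (use Suc(3,4) K \<epsilon> c0 c1 in \<open>auto intro!: continuous_intros\<close>)
  also have "\<epsilon> powr (- 1 / p) = \<mu> powr (- 1 / Suc p)"
    using Suc(1) by (simp add: \<epsilon>_def powr_powr)
  also have "2 * \<epsilon> / \<mu> = 2 * \<mu> powr (- 1 / Suc p)"
  proof -
    have "\<epsilon> / \<mu> = \<mu> powr (p / Suc p - 1)"
      using Suc(4) by (simp add: \<epsilon>_def powr_diff)
    also have "p / Suc p - 1 = - 1 / Suc p" by (simp add: field_simps)
    finally show ?thesis by simp
  qed
  finally show ?case by (simp add: K_def algebra_simps)
qed


section \<open>Decay without amplitude, uniform in the linear part of the phase\<close>

lemma C_on_has_vector_derivative:
  assumes "C_on n f S" "p < n" "x \<in> S"
  shows "(nth_deriv p f has_vector_derivative nth_deriv (Suc p) f x) (at x)"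
  using assms by (simp add: C_on_def nth_deriv_def vector_derivative_works)

lemma C_on_isCont:
  assumes "C_on n f S" "open S" "p \<le> n" "x \<in> S"
  shows "isCont (nth_deriv p f) x"
proof (cases "p = n")
  case True
  then show ?thesis using assms by (simp add: C_on_def continuous_on_eq_continuous_at)
next
  case False
  then show ?thesis using assms C_on_has_vector_derivative[of n f S p x]
    by (intro has_vector_derivative_continuous) auto
qed

text \<open>Compactness enters as a bisection argument: the estimate holds on short intervals around
  each point, where one derivative of order \<open>p\<close> dominates, and it survives gluing
  adjacent intervals. Asking for it on all subintervals \<open>{c..d}\<close> makes gluing possible
  and later provides the bound on primitives that integration by parts needs.\<close>

lemma oscillatory_decay:
  fixes g :: "real \<Rightarrow> real"
  assumes A: "0 < A" "A \<le> B" and lam: "0 < lam" and l: "2 \<le> l" and g: "C_on l g {0<..}"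
    and lower: "\<And>y. y \<in> {A..B} \<Longrightarrow> lam \<le> (\<Sum>p=2..l. \<bar>nth_deriv p g y\<bar>)"
  shows "\<exists>C\<ge>0. \<forall>X T c d. T \<noteq> 0 \<longrightarrow> A \<le> c \<longrightarrow> c \<le> d \<longrightarrow> d \<le> B \<longrightarrow>
    cmod (integral {c..d} (\<lambda>u. cis (X * u + T * g u))) \<le> C * \<bar>T\<bar> powr (- 1 / l)"
proof -
  have nd: "(nth_deriv p g has_real_derivative nth_deriv (Suc p) g x) (at x within S)"
    if "p < l" "0 < x" for p x S
    using C_on_has_vector_derivative[OF g, of p x] that
    by (auto simp: has_real_derivative_iff_has_vector_derivative intro: has_vector_derivative_at_within)
  have nc: "continuous_on {c..d} (nth_deriv p g)" if "p \<le> l" "0 < c" for p c d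
    using C_on_isCont[OF g _ that(1)] that(2) by (auto intro!: continuous_at_imp_continuous_on)
  have g0: "nth_deriv 0 g = g" by (simp add: nth_deriv_def)
  have int: "(\<lambda>u. cis (X * u + T * g u)) integrable_on {c..d}" if "0 < c" for X T c d
    using nc[of 0 c d] that unfolding g0
    by (intro integrable_continuous_real continuous_intros) auto
  define bnd where "bnd C a b \<longleftrightarrow> (\<forall>X T c d. T \<noteq> 0 \<longrightarrow> a \<le> c \<longrightarrow> c \<le> d \<longrightarrow> d \<le> b \<longrightarrow>
    cmod (integral {c..d} (\<lambda>u. cis (X * u + T * g u))) \<le> C * \<bar>T\<bar> powr (- 1 / l))" for C a b
  \<comment> \<open>Bisection asks for the property on short intervals that may leave
    \<open>{A..B}\<close>. Carrying positivity of the left endpoint along keeps them inside the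
    domain where \<open>g\<close> is regular.\<close>
  have "0 < A \<and> (\<exists>C\<ge>0. bnd C A B)" using A(2)
  proof (induction rule: Bolzano)
    case (trans a b c)
    then obtain C1 C2 where a: "0 < a" and C: "0 \<le> C1" "0 \<le> C2" and C12: "bnd C1 a b" "bnd C2 b c"
      by blast
    have "cmod (integral {u..v} (\<lambda>u. cis (X * u + T * g u))) \<le> (C1 + C2) * \<bar>T\<bar> powr (- 1 / l)"
      if T: "T \<noteq> 0" and uv: "a \<le> u" "u \<le> v" "v \<le> c" for X T u v
    proof -
      define E where "E = (\<lambda>u. cis (X * u + T * g u))"
      have C1: "cmod (integral {u..v} E) \<le> C1 * \<bar>T\<bar> powr (- 1 / l)" if "a \<le> u" "u \<le> v" "v \<le> b" for u v
        using C12(1) that T unfolding bnd_def E_def by blast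
      have C2: "cmod (integral {u..v} E) \<le> C2 * \<bar>T\<bar> powr (- 1 / l)" if "b \<le> u" "u \<le> v" "v \<le> c" for u v
        using C12(2) that T unfolding bnd_def E_def by blast
      have w: "0 \<le> C1 * \<bar>T\<bar> powr (- 1 / l)" "0 \<le> C2 * \<bar>T\<bar> powr (- 1 / l)" using C by auto
      \<comment> \<open>An interval that crosses \<open>b\<close> is cut there, so the constants of
        the two halves add up.\<close>
      consider "v \<le> b" | "b \<le> u" | "u \<le> b" "b \<le> v" by linarith
      then have "cmod (integral {u..v} E) \<le> C1 * \<bar>T\<bar> powr (- 1 / l) + C2 * \<bar>T\<bar> powr (- 1 / l)"
      proof cases
        case 1
        then show ?thesis using C1[of u v] uv w by linarith
      next
        case 2
        then show ?thesis using C2[of u v] uv w by linarith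
      next
        case 3
        have "integral {u..v} E = integral {u..b} E + integral {b..v} E"
          unfolding E_def using 3 a uv int
          by (intro Henstock_Kurzweil_Integration.integral_combine[symmetric]) auto
        then show ?thesis
          using norm_triangle_ineq[of "integral {u..b} E" "integral {b..v} E"] C1[of u b] C2[of b v] 3 uv
          by simp
      qed
      then show ?thesis by (simp add: E_def distrib_right)
    qed
    then have "bnd (C1 + C2) a c" unfolding bnd_def by blast
    then show ?case using C a by (intro conjI exI[of _ "C1 + C2"]) auto
  next
    case (local x)
    then have x: "0 < x" using A by linarith
    \<comment> \<open>Pigeonhole: the sum has fewer than \<open>l\<close> terms, so if all of them
      were below \<open>lam / l\<close> the sum would be below \<open>lam\<close>.\<close>
    define \<kappa> where "\<kappa> = lam / l"
    have \<kappa>: "0 < \<kappa>" using lam l by (simp add: \<kappa>_def)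
    have "\<exists>p\<in>{2..l}. \<kappa> \<le> \<bar>nth_deriv p g x\<bar>"
    proof (rule ccontr)
      assume "\<not> ?thesis"
      then have "(\<Sum>p=2..l. \<bar>nth_deriv p g x\<bar>) < of_nat (card {2..l}) * \<kappa>"
        using l by (intro sum_bounded_above_strict) (auto simp: not_le)
      also have "\<dots> \<le> l * \<kappa>" using \<kappa> by (intro mult_right_mono) auto
      also have "\<dots> = lam" using l by (simp add: \<kappa>_def)
      finally show False using lower[of x] local by auto
    qed
    then obtain p where p: "2 \<le> p" "p \<le> l" "\<kappa> \<le> \<bar>nth_deriv p g x\<bar>" by auto
    have "isCont (nth_deriv p g) x"
      using C_on_isCont[OF g _ p(2)] x by auto
    then obtain \<eta> where \<eta>: "0 < \<eta>" "\<And>y. \<bar>y - x\<bar> < \<eta> \<Longrightarrow> \<bar>nth_deriv p g y - nth_deriv p g x\<bar> < \<kappa> / 2"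
      using \<kappa> unfolding continuous_at_eps_delta by (metis dist_real_def half_gt_zero)
    have near: "\<kappa> / 2 \<le> \<bar>nth_deriv p g y\<bar>" if "\<bar>y - x\<bar> < \<eta>" for y
      using \<eta>(2)[OF that] p(3) by linarith
    have "0 < a \<and> (\<exists>C\<ge>0. bnd C a b)"
      if ab: "a \<le> x" "x \<le> b" "b - a < min \<eta> x" for a b
    proof -
      define K where "K = (3 * 2 ^ p - 2) * (\<kappa> / 2) powr (- 1 / p)"
      have "(1::real) \<le> 2 ^ p" by simp
      then have "(0::real) \<le> 3 * 2 ^ p - 2" by linarith
      then have K: "0 \<le> K" by (simp add: K_def)
      \<comment> \<open>In the constant, \<open>K\<close> comes from van der Corput's lemma and
        serves \<open>1 \<le> \<bar>T\<bar>\<close>; the length \<open>b - a\<close> comes from the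
        trivial bound and serves \<open>\<bar>T\<bar> < 1\<close>.\<close>
      have "cmod (integral {c..d} (\<lambda>u. cis (X * u + T * g u))) \<le> (K + (b - a)) * \<bar>T\<bar> powr (- 1 / l)"
        if T: "T \<noteq> 0" and cd: "a \<le> c" "c \<le> d" "d \<le> b" for X T c d
      proof (cases "1 \<le> \<bar>T\<bar>")
        case True
        \<comment> \<open>These are the successive derivatives of the phase. The linear term
          survives only for \<open>i = 0\<close> and \<open>i = 1\<close>, so \<open>D p\<close>
          with \<open>2 \<le> p\<close> is free of \<open>X\<close>, and so is the resulting
          bound.\<close>
        define D where "D = (\<lambda>i u. T * nth_deriv i g u + (if i = 0 then X * u else if i = 1 then X else 0))"
        have D0: "D 0 u = X * u + T * g u" for u by (simp add: D_def g0)
        have "cmod (integral {c..d} (\<lambda>u. cis (D 0 u))) \<le> (3 * 2 ^ p - 2) * (\<bar>T\<bar> * (\<kappa> / 2)) powr (- 1 / p)"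
        proof (rule van_der_Corput[OF p(1) cd(2)])
          show "0 < \<bar>T\<bar> * (\<kappa> / 2)" using T \<kappa> by simp
          show "continuous_on {c..d} (D p)"
            using p ab cd unfolding D_def by (auto intro!: continuous_intros nc)
          fix y assume y: "y \<in> {c..d}"
          then have y0: "0 < y" "\<bar>y - x\<bar> < \<eta>" using ab cd by auto
          have "D p y = T * nth_deriv p g y" using p by (simp add: D_def)
          then show "\<bar>T\<bar> * (\<kappa> / 2) \<le> \<bar>D p y\<bar>"
            using mult_left_mono[OF near[OF y0(2)], of "\<bar>T\<bar>"] by (simp add: abs_mult)
          fix i assume i: "i < p"
          have "((\<lambda>u. if i = 0 then X * u else if i = 1 then X else 0) has_real_derivative
                 (if Suc i = 0 then X * y else if Suc i = 1 then X else 0)) (at y within {c..d})"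
            by (cases "i = 0") (auto intro!: derivative_eq_intros)
          then show "(D i has_real_derivative D (Suc i) y) (at y within {c..d})"
            unfolding D_def using nd[of i y "{c..d}"] i p y0
            by (intro DERIV_add DERIV_cmult) auto
        qed
        also have "\<dots> = K * \<bar>T\<bar> powr (- 1 / p)" by (simp only: K_def powr_mult mult_ac)
        also have "\<dots> \<le> K * \<bar>T\<bar> powr (- 1 / l)"
          using True K p by (intro mult_left_mono powr_mono) (auto simp: field_simps)
        also have "\<dots> \<le> (K + (b - a)) * \<bar>T\<bar> powr (- 1 / l)"
          using ab by (intro mult_right_mono) auto
        finally show ?thesis unfolding D0 .
      next
        case False
        have c0: "0 < c" using ab cd by auto
        have "cmod (integral {c..d} (\<lambda>u. cis (X * u + T * g u))) \<le> 1 * (d - c)"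
          using cd nc[of 0 c d] c0 unfolding g0
          by (intro integral_bound continuous_intros) auto
        also have "\<dots> \<le> (K + (b - a)) * 1" using cd K by simp
        also have "\<dots> \<le> (K + (b - a)) * \<bar>T\<bar> powr (- 1 / l)"
        proof (rule mult_left_mono)
          have "\<bar>T\<bar> powr 0 \<le> \<bar>T\<bar> powr (- 1 / l)"
            using False by (intro powr_mono') auto
          then show "1 \<le> \<bar>T\<bar> powr (- 1 / l)" using T by simp
        qed (use K ab in auto)
        finally show ?thesis .
      qed
      then have "bnd (K + (b - a)) a b" unfolding bnd_def by blast
      then show ?thesis using K ab by (intro conjI exI[of _ "K + (b - a)"]) auto
    qed
    then show ?case using \<eta>(1) x by (intro exI[of _ "min \<eta> x"]) auto
  qed
  then show ?thesis unfolding bnd_def by blast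
qed

section \<open>Inserting the amplitude and rescaling\<close>

text \<open>Integration by parts against the primitive of \<open>e\<close> that vanishes at
  \<open>A\<close>: only the boundary term at \<open>B\<close> remains, and the primitive is bounded
  by \<open>M\<close> throughout.\<close>

lemma norm_integral_mult_le:
  fixes e a a' :: "real \<Rightarrow> complex"
  assumes AB: "A \<le> B" and e: "continuous_on {A..B} e"
    and da: "\<And>x. x \<in> {A..B} \<Longrightarrow> (a has_vector_derivative a' x) (at x within {A..B})"
    and ca': "continuous_on {A..B} a'"
    and M: "\<And>y. y \<in> {A..B} \<Longrightarrow> cmod (integral {A..y} e) \<le> M"
  shows "cmod (integral {A..B} (\<lambda>x. e x * a x)) \<le> M * (cmod (a B) + integral {A..B} (\<lambda>x. cmod (a' x)))"
proof -
  define F where "F = (\<lambda>y. integral {A..y} e)"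
  have dF: "(F has_vector_derivative e x) (at x within {A..B})" if "x \<in> {A..B}" for x
    unfolding F_def using e that by (rule integral_has_vector_derivative)
  have cF: "continuous_on {A..B} F"
    using has_vector_derivative_continuous[OF dF] by (auto simp: continuous_on_eq_continuous_within)
  have "((\<lambda>x. F x * a' x + e x * a x) has_integral (F B * a B - F A * a A)) {A..B}"
    using AB by (intro fundamental_theorem_of_calculus has_vector_derivative_mult dF da)
  moreover have iFa: "(\<lambda>x. F x * a' x) integrable_on {A..B}"
    by (intro integrable_continuous_real continuous_intros cF ca')
  ultimately have "((\<lambda>x. (F x * a' x + e x * a x) - F x * a' x) has_integral
      (F B * a B - F A * a A - integral {A..B} (\<lambda>x. F x * a' x))) {A..B}"
    by (intro has_integral_diff integrable_integral)
  then have eq: "integral {A..B} (\<lambda>x. e x * a x) = F B * a B - integral {A..B} (\<lambda>x. F x * a' x)"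
    by (simp add: integral_unique F_def)
  have ica': "(\<lambda>x. cmod (a' x)) integrable_on {A..B}"
    by (intro integrable_continuous_real continuous_intros ca')
  have "cmod (integral {A..B} (\<lambda>x. F x * a' x)) \<le> integral {A..B} (\<lambda>x. M * cmod (a' x))"
    using M ica' iFa
    by (intro Henstock_Kurzweil_Integration.integral_norm_bound_integral)
      (auto simp: norm_mult F_def intro!: mult_right_mono integrable_on_mult_right)
  also have "\<dots> = M * integral {A..B} (\<lambda>x. cmod (a' x))" by simp
  finally have 1: "cmod (integral {A..B} (\<lambda>x. F x * a' x)) \<le> M * integral {A..B} (\<lambda>x. cmod (a' x))" .
  have "cmod (F B * a B) \<le> M * cmod (a B)"
    using M[of B] AB by (auto simp: norm_mult F_def intro!: mult_right_mono)
  then show ?thesis unfolding eq using 1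
    norm_triangle_ineq4[of "F B * a B" "integral {A..B} (\<lambda>x. F x * a' x)"]
    by (simp add: distrib_left)
qed


lemma oscillatory_decay_amplitude:
  fixes g :: "real \<Rightarrow> real" and a a' :: "real \<Rightarrow> complex"
  assumes A: "0 < A" "A \<le> B" and lam: "0 < lam" and l: "2 \<le> l" and g: "C_on l g {0<..}"
    and lower: "\<And>y. y \<in> {A..B} \<Longrightarrow> lam \<le> (\<Sum>p=2..l. \<bar>nth_deriv p g y\<bar>)"
    and da: "\<And>x. x \<in> {A..B} \<Longrightarrow> (a has_vector_derivative a' x) (at x within {A..B})"
    and ca': "continuous_on {A..B} a'"
  shows "\<exists>C\<ge>0. \<forall>X T. T \<noteq> 0 \<longrightarrow>
    cmod (integral {A..B} (\<lambda>u. cis (X * u + T * g u) * a u)) \<le> C * \<bar>T\<bar> powr (- 1 / l)"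
proof -
  obtain C where C: "0 \<le> C"
    and bound: "\<And>X T c d. T \<noteq> 0 \<Longrightarrow> A \<le> c \<Longrightarrow> c \<le> d \<Longrightarrow> d \<le> B \<Longrightarrow>
      cmod (integral {c..d} (\<lambda>u. cis (X * u + T * g u))) \<le> C * \<bar>T\<bar> powr (- 1 / l)"
    using oscillatory_decay[OF A lam l g lower] by blast
  \<comment> \<open>\<open>V\<close> depends on the amplitude alone, so \<open>C * V\<close> is
    uniform in \<open>X\<close> and \<open>T\<close>.\<close>
  define V where "V = cmod (a B) + integral {A..B} (\<lambda>x. cmod (a' x))"
  have "0 \<le> integral {A..B} (\<lambda>x. cmod (a' x))"
    using ca' by (intro integral_nonneg integrable_continuous_real continuous_intros) auto
  then have V: "0 \<le> V" by (simp add: V_def)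
  have "isCont g x" if "0 < x" for x
    using C_on_isCont[OF g, of 0 x] that by (simp add: nth_deriv_def)
  then have cg: "continuous_on {A..B} g"
    using A by (intro continuous_at_imp_continuous_on) auto
  have "cmod (integral {A..B} (\<lambda>u. cis (X * u + T * g u) * a u)) \<le> C * \<bar>T\<bar> powr (- 1 / l) * V"
    if "T \<noteq> 0" for X T
    unfolding V_def using that bound A cg da ca'
    by (intro norm_integral_mult_le continuous_intros) auto
  then show ?thesis using C V
    by (intro exI[of _ "C * V"]) (auto simp: mult_ac)
qed

text \<open>Common form of both estimates, with \<open>b\<close> a dyadic cutoff or a sum of them.
  Under \<open>y = \<delta> * \<xi>\<close> the measure yields \<open>\<delta> powr (- 1)\<close>,
  the weight yields \<open>\<delta> powr (- s)\<close>, and the decay in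
  \<open>T = t / \<delta>\<close> yields \<open>\<delta> powr (1 / l)\<close>; these multiply to the
  stated power. The factor \<open>y powr s\<close> joins the amplitude, where it is harmless because
  \<open>A\<close> is positive. The support condition concerns positive \<open>y\<close> only, since
  the even cutoffs also live on the negative axis.\<close>

lemma scaled_oscillatory_decay:
  fixes g :: "real \<Rightarrow> real" and b b' :: "real \<Rightarrow> complex" and s :: real
  assumes A: "0 < A" "A \<le> B" and lam: "0 < lam" and l: "2 \<le> l" and g: "C_on l g {0<..}"
    and lower: "\<And>y. y \<in> {A..B} \<Longrightarrow> lam \<le> (\<Sum>p=2..l. \<bar>nth_deriv p g y\<bar>)"
    and db: "\<And>x. (b has_vector_derivative b' x) (at x)" and cb': "continuous_on UNIV b'"
    and supp_b: "\<And>y. 0 < y \<Longrightarrow> b y \<noteq> 0 \<Longrightarrow> y \<in> {A..B}"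
  shows "\<exists>C\<ge>0. \<forall>\<delta>>0. \<forall>t x. t \<noteq> 0 \<longrightarrow>
    cmod (LINT \<xi>:{0<..}|lborel. exp (\<i> * of_real (x * \<xi>)) * exp (\<i> * of_real (t / \<delta> * g (\<delta> * \<xi>)))
        * b (\<delta> * \<xi>) * of_real (\<xi> powr s))
      \<le> C * (\<delta> powr (- (s + 1 - 1 / real l)) / \<bar>t\<bar> powr (1 / real l))"
proof -
  define a where "a = (\<lambda>y. b y * of_real (y powr s))"
  define a' where "a' = (\<lambda>y. b y * of_real (s * y powr (s - 1)) + b' y * of_real (y powr s))"
  have cb: "continuous_on UNIV b"
    using db by (auto simp: continuous_on_eq_continuous_within intro: has_vector_derivative_continuous)
  have cg: "continuous_on {A..B} g"
  proof (rule continuous_at_imp_continuous_on, rule ballI)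
    fix x assume "x \<in> {A..B}"
    then show "isCont g x" using C_on_isCont[OF g, of 0 x] A by (simp add: nth_deriv_def)
  qed
  have ca: "continuous_on {A..B} a"
    unfolding a_def using A by (intro continuous_intros continuous_on_subset[OF cb]) auto
  have da: "(a has_vector_derivative a' x) (at x within {A..B})" if "x \<in> {A..B}" for x
    unfolding a_def a'_def using that A db
    by (intro has_vector_derivative_mult has_vector_derivative_of_real has_vector_derivative_at_within[OF db]
        DERIV_subset[OF has_real_derivative_powr]) auto
  have ca': "continuous_on {A..B} a'"
    unfolding a'_def using A
    by (intro continuous_intros continuous_on_subset[OF cb] continuous_on_subset[OF cb']) auto
  obtain C where C: "0 \<le> C" and bound: "\<And>X T. T \<noteq> 0 \<Longrightarrow>
    cmod (integral {A..B} (\<lambda>u. cis (X * u + T * g u) * a u)) \<le> C * \<bar>T\<bar> powr (- 1 / l)"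
    using oscillatory_decay_amplitude[OF A lam l g lower da ca'] by blast
  have "cmod (LINT \<xi>:{0<..}|lborel. exp (\<i> * of_real (x * \<xi>)) * exp (\<i> * of_real (t / \<delta> * g (\<delta> * \<xi>)))
        * b (\<delta> * \<xi>) * of_real (\<xi> powr s))
      \<le> C * (\<delta> powr (- (s + 1 - 1 / real l)) / \<bar>t\<bar> powr (1 / real l))"
    if \<delta>: "0 < \<delta>" and t: "t \<noteq> 0" for \<delta> t x
  proof -
    define X T where "X = x / \<delta>" and "T = t / \<delta>"
    have T: "T \<noteq> 0" using \<delta> t by (simp add: T_def)
    define f where "f = (\<lambda>\<xi>. indicat_real {0<..} \<xi> *\<^sub>R (exp (\<i> * of_real (x * \<xi>)) *
      exp (\<i> * of_real (t / \<delta> * g (\<delta> * \<xi>))) * b (\<delta> * \<xi>) * of_real (\<xi> powr s)))"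
    define h where "h = (\<lambda>y. cis (X * y + T * g y) * a y)"
    \<comment> \<open>Off \<open>{A..B}\<close> both sides vanish: for positive \<open>y\<close> by
      the support of \<open>b\<close>, otherwise by the indicator of the half-line.\<close>
    have f_eq: "f (0 + 1 / \<delta> * y) = \<delta> powr (- s) *\<^sub>R (indicat_real {A..B} y *\<^sub>R h y)" for y
    proof (cases "y \<in> {A..B}")
      case True
      then have y: "0 < y" "0 < y / \<delta>" using A \<delta> by auto
      have 1: "(y / \<delta>) powr s = \<delta> powr (- s) * y powr s"
        by (simp only: powr_divide powr_minus) (simp add: divide_inverse mult.commute)
      have 2: "exp (\<i> * of_real (x * (y / \<delta>))) * exp (\<i> * of_real (t / \<delta> * g (\<delta> * (y / \<delta>)))) = cis (X * y + T * g y)"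
        using \<delta> by (simp add: cis_conv_exp X_def T_def exp_add distrib_left)
      have "f (y / \<delta>) = (exp (\<i> * of_real (x * (y / \<delta>))) * exp (\<i> * of_real (t / \<delta> * g (\<delta> * (y / \<delta>)))))
           * b y * of_real ((y / \<delta>) powr s)"
        using y \<delta> by (simp add: f_def)
      also have "\<dots> = \<delta> powr (- s) *\<^sub>R h y"
        unfolding 1 2 by (simp add: h_def a_def scaleR_conv_of_real mult_ac)
      finally show ?thesis using True by simp
    next
      case False
      have "f (y / \<delta>) = 0"
      proof (cases "0 < y")
        case True
        then have "b y = 0" using supp_b False by blast
        then show ?thesis using \<delta> by (simp add: f_def)
      next
        case False
        then have "y / \<delta> \<notin> {0<..}" using \<delta> by (simp add: zero_less_divide_iff)
        then show ?thesis by (simp add: f_def)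
      qed
      then show ?thesis using False by simp
    qed
    have "(LINT \<xi>|lborel. f \<xi>) = \<bar>1 / \<delta>\<bar> *\<^sub>R (LINT y|lborel. f (0 + 1 / \<delta> * y))"
      using \<delta> by (intro lborel_integral_real_affine) simp
    also have "\<dots> = (1 / \<delta> * \<delta> powr (- s)) *\<^sub>R (LINT y:{A..B}|lborel. h y)"
      unfolding f_eq set_lebesgue_integral_def integral_scaleR_right using \<delta> by simp
    also have "(LINT y:{A..B}|lborel. h y) = integral {A..B} h"
      unfolding h_def
      by (intro set_borel_integral_eq_integral borel_integrable_atLeastAtMost' continuous_intros ca cg)
    finally have "cmod (LINT \<xi>|lborel. f \<xi>) = 1 / \<delta> * \<delta> powr (- s) * cmod (integral {A..B} h)"
      using \<delta> by simp
    also have "\<dots> \<le> 1 / \<delta> * \<delta> powr (- s) * (C * \<bar>T\<bar> powr (- 1 / l))"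
      using bound[OF T, of X] \<delta> by (intro mult_left_mono) (auto simp: h_def)
    also have "\<bar>T\<bar> powr (- 1 / l) = \<delta> powr (1 / l) / \<bar>t\<bar> powr (1 / l)"
    proof -
      have "\<bar>T\<bar> powr (- (1 / l)) = \<bar>t\<bar> powr (- (1 / l)) / \<delta> powr (- (1 / l))"
        using \<delta> by (simp only: T_def abs_divide powr_divide abs_of_pos)
      then show ?thesis by (simp add: powr_minus divide_inverse mult.commute)
    qed
    also have "1 / \<delta> * \<delta> powr (- s) * (C * (\<delta> powr (1 / l) / \<bar>t\<bar> powr (1 / l)))
        = C * ((\<delta> powr (- 1) * \<delta> powr (- s) * \<delta> powr (1 / l)) / \<bar>t\<bar> powr (1 / l))"
      using \<delta> by (simp add: powr_minus_divide)
    also have "\<delta> powr (- 1) * \<delta> powr (- s) * \<delta> powr (1 / l) = \<delta> powr (- (s + 1 - 1 / l))"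
      by (simp only: powr_add[symmetric]) (simp add: algebra_simps)
    finally show ?thesis by (simp add: f_def set_lebesgue_integral_def)
  qed
  then show ?thesis using C by blast
qed

section \<open>Regularity and support of the cutoffs\<close>

lemma smooth_C1:
  assumes "smooth f"
  shows "(f has_vector_derivative nth_deriv 1 f x) (at x)" "continuous_on UNIV (nth_deriv 1 f)"
proof -
  have C: "C_on 1 f UNIV" using assms by (simp add: smooth_def)
  show "continuous_on UNIV (nth_deriv 1 f)" using C by (simp add: C_on_def)
  show "(f has_vector_derivative nth_deriv 1 f x) (at x)"
    using C_on_has_vector_derivative[OF C, of 0 x] by (simp add: nth_deriv_def)
qed

text \<open>Taking logarithms confines \<open>k\<close> to a bounded range. Finiteness makes the sum
  over \<open>k\<close> a genuine one, not the default value 0, and lets a single constant serve all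
  admissible \<open>k\<close>.\<close>

lemma finite_dyadic_between:
  fixes y0 y1 :: real
  assumes "0 < y0"
  shows "finite {k::int. y0 \<le> 2 powi k \<and> 2 powi k \<le> y1}"
proof (rule finite_subset)
  show "{k::int. y0 \<le> 2 powi k \<and> 2 powi k \<le> y1} \<subseteq> {\<lfloor>log 2 y0\<rfloor>..\<lceil>log 2 y1\<rceil>}"
  proof
    fix k :: int assume "k \<in> {k. y0 \<le> 2 powi k \<and> 2 powi k \<le> y1}"
    then have k: "y0 \<le> 2 powr k" "2 powr k \<le> y1" by (auto simp: powr_real_of_int')
    then have "0 < y1" using assms by linarith
    then have "log 2 y0 \<le> k" "k \<le> log 2 y1" using k assms
      by (auto simp: log_le_iff le_log_iff)
    then show "k \<in> {\<lfloor>log 2 y0\<rfloor>..\<lceil>log 2 y1\<rceil>}" by (simp, linarith)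
  qed
qed simp

lemma annular_cutoff_nonzero:
  assumes "annular_cutoff P" "P y \<noteq> 0"
  shows "1/2 \<le> \<bar>y\<bar>" "\<bar>y\<bar> \<le> 2"
proof -
  have "y \<in> supp P" unfolding supp_def using assms(2) closure_subset by fastforce
  then show "1/2 \<le> \<bar>y\<bar>" "\<bar>y\<bar> \<le> 2" using assms(1) by (auto simp: annular_cutoff_def)
qed

text \<open>With \<open>r = y / 2 powi k\<close> the value is
  \<open>\<phi>0 (r / 2) - \<phi>0 r\<close>. For \<open>r \<le> 3/5\<close> both terms are 1 and
  cancel; for \<open>r > 8/5\<close> both are 0. Hence \<open>r\<close> lies between
  \<open>3/5\<close> and \<open>8/5\<close>, well within \<open>1/2\<close> and
  \<open>2\<close>.\<close>

lemma lp_Q_nonzero: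
  assumes \<phi>0: "lp_generator \<phi>0" and y: "0 < y" and nz: "lp_Q \<phi>0 k y \<noteq> 0"
  shows "2 powi k / 2 \<le> y" "y \<le> 2 * 2 powi k"
proof -
  have one: "\<phi>0 z = 1" if "\<bar>z\<bar> \<le> 3/5" for z
  proof -
    have "\<forall>y\<in>{-3/5..3/5}. \<phi>0 y = 1" using \<phi>0 unfolding lp_generator_def by blast
    moreover have "-3/5 \<le> z" "z \<le> 3/5" using that by linarith+
    then have "z \<in> {-3/5..3/5}" by (simp only: atLeastAtMost_iff simp_thms)
    ultimately show ?thesis by blast
  qed
  have zero: "\<phi>0 z = 0" if "\<bar>z\<bar> > 4/5" for z
  proof (rule ccontr)
    assume "\<phi>0 z \<noteq> 0"
    then have "z \<in> supp \<phi>0" unfolding supp_def using closure_subset by fastforce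
    moreover have "supp \<phi>0 \<subseteq> {-4/5..4/5}" using \<phi>0 by (simp only: lp_generator_def)
    ultimately have "z \<in> {-4/5..4/5}" by blast
    then have "-4/5 \<le> z" "z \<le> 4/5" by (simp_all only: atLeastAtMost_iff)
    then show False using that by linarith
  qed
  define r where "r = y / 2 powi k"
  have pos: "(0::real) < 2 powi k" by simp
  have r: "0 < r" using y by (simp add: r_def)
  have eq1: "2 powi (- k) * y = r"
    unfolding r_def power_int_minus divide_inverse by (rule mult.commute)
  have "2 powi (- k - 1) * y = 2 powi (- k) * y / 2"
    using power_int_diff[of "2::real" "- k" 1] by simp
  note eq = eq1 this[unfolded eq1]
  have "\<not> r \<le> 3/5"
    using nz one[of r] one[of "r / 2"] r unfolding lp_Q_def eq by auto
  moreover have "\<not> 4/5 < r / 2"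
    using nz zero[of r] zero[of "r / 2"] r unfolding lp_Q_def eq by auto
  ultimately have "1/2 \<le> r" "r \<le> 2" by auto
  then show "2 powi k / 2 \<le> y" "y \<le> 2 * 2 powi k"
    using pos by (auto simp: r_def field_simps)
qed


lemma lp_Q_C1:
  assumes "lp_generator \<phi>0"
  shows "\<exists>q'. (\<forall>y. (lp_Q \<phi>0 k has_real_derivative q' y) (at y)) \<and> continuous_on UNIV q'"
proof -
  define c1 c2 :: real where "c1 = 2 powi (- k - 1)" and "c2 = 2 powi (- k)"
  define D where "D = nth_deriv 1 \<phi>0"
  have sm: "smooth \<phi>0" using assms by (simp add: lp_generator_def)
  have d: "(\<phi>0 has_real_derivative D y) (at y)" for y
    using smooth_C1(1)[OF sm] by (simp add: D_def has_real_derivative_iff_has_vector_derivative)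
  have c: "continuous_on UNIV D" using smooth_C1(2)[OF sm] by (simp add: D_def)
  have lin: "((\<lambda>y. r * y) has_real_derivative r) (at y)" for r y :: real
    by (auto intro!: derivative_eq_intros)
  have Q: "lp_Q \<phi>0 k = (\<lambda>y. \<phi>0 (c1 * y) - \<phi>0 (c2 * y))"
    by (simp add: fun_eq_iff lp_Q_def c1_def c2_def)
  show ?thesis
  proof (intro exI conjI allI)
    show "(lp_Q \<phi>0 k has_real_derivative D (c1 * y) * c1 - D (c2 * y) * c2) (at y)" for y
      unfolding Q by (intro DERIV_diff DERIV_chain2[OF d] lin)
    show "continuous_on UNIV (\<lambda>y. D (c1 * y) * c1 - D (c2 * y) * c2)"
      by (intro continuous_intros continuous_on_compose2[OF c]) auto
  qed
qed

section \<open>Reduction to the half-line and the two estimates\<close>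

text \<open>The line is split at the origin and the negative half is reflected. If \<open>F\<close>
  is not integrable, its integral is 0 by convention and the bound is trivial, so integrability need
  not be assumed.\<close>

lemma norm_integral_le_half_lines:
  fixes F p m :: "real \<Rightarrow> complex"
  assumes F0: "F 0 = 0" and pos: "\<And>\<xi>. 0 < \<xi> \<Longrightarrow> F \<xi> = p \<xi>" and neg: "\<And>\<xi>. 0 < \<xi> \<Longrightarrow> F (- \<xi>) = m \<xi>"
  shows "cmod (LINT \<xi>|lborel. F \<xi>) \<le> cmod (LINT \<xi>:{0<..}|lborel. p \<xi>) + cmod (LINT \<xi>:{0<..}|lborel. m \<xi>)"
proof (cases "integrable lborel F")
  case True
  have F_eq: "F \<xi> = indicat_real {0<..} \<xi> *\<^sub>R F \<xi> + indicat_real {..<0} \<xi> *\<^sub>R F \<xi>" for \<xi>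
    using F0 by (cases "\<xi> = 0") (auto simp: indicator_def)
  have "(LINT \<xi>|lborel. F \<xi>) = (LINT \<xi>|lborel. indicat_real {0<..} \<xi> *\<^sub>R F \<xi>) + (LINT \<xi>|lborel. indicat_real {..<0} \<xi> *\<^sub>R F \<xi>)"
    by (subst F_eq, rule Bochner_Integration.integral_add) (intro integrable_mult_indicator True, simp)+
  also have "(\<lambda>\<xi>. indicat_real {0<..} \<xi> *\<^sub>R F \<xi>) = (\<lambda>\<xi>. indicat_real {0<..} \<xi> *\<^sub>R p \<xi>)"
    using pos by (auto simp: indicator_def of_bool_def fun_eq_iff)
  also have "(LINT \<xi>|lborel. indicat_real {..<0} \<xi> *\<^sub>R F \<xi>) =
      (LINT \<xi>|lborel. indicat_real {..<0} (0 + (-1) * \<xi>) *\<^sub>R F (0 + (-1) * \<xi>))"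
    using lborel_integral_real_affine[of "-1" "\<lambda>\<xi>. indicat_real {..<0} \<xi> *\<^sub>R F \<xi>" 0] by simp
  also have "(\<lambda>\<xi>. indicat_real {..<0} (0 + (-1) * \<xi>) *\<^sub>R F (0 + (-1) * \<xi>)) = (\<lambda>\<xi>. indicat_real {0<..} \<xi> *\<^sub>R m \<xi>)"
    using neg by (auto simp: indicator_def of_bool_def fun_eq_iff)
  finally show ?thesis by (simp add: set_lebesgue_integral_def norm_triangle_ineq)
next
  case False
  then show ?thesis by (simp add: not_integrable_integral_eq)
qed

theorem lemma2p9:
  fixes P :: "real \<Rightarrow> complex" and \<phi>0 :: "real \<Rightarrow> real" and g :: "real \<Rightarrow> real"
    and lam y0 y1 s :: real and l :: nat
  assumes P: "annular_cutoff P"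
    and \<phi>0: "lp_generator \<phi>0"
    and lam: "0 < lam"
    and y0: "0 < y0"
    and y1: "y0 \<le> y1"
    and l: "2 \<le> l"
    and g: "C_on l g {0<..}"
    and lower: "\<And>y. y \<in> {y0 / 2..2 * y1} \<Longrightarrow> lam \<le> (\<Sum>p=2..l. \<bar>nth_deriv p g y\<bar>)"
  shows "\<exists>C>0. \<forall>\<delta>>0. \<forall>t. t \<noteq> 0 \<longrightarrow>
     (\<forall>k::int. y0 \<le> 2 powi k \<and> 2 powi k \<le> y1 \<longrightarrow>
        (SUP x. ereal (cmod (osc_I P g s \<delta> t x k)))
          \<le> ereal (C * (\<delta> powr (- (s + 1 - 1 / real l)) / \<bar>t\<bar> powr (1 / real l)))) \<and>
     (SUP x. ereal (cmod (osc_J \<phi>0 g s y0 y1 \<delta> t x)))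
       \<le> ereal (C * (\<delta> powr (- (s + 1 - 1 / real l)) / \<bar>t\<bar> powr (1 / real l)))"
proof -
  define K where "K = {k::int. y0 \<le> 2 powi k \<and> 2 powi k \<le> y1}"
  define W where "W \<delta> t = \<delta> powr (- (s + 1 - 1 / real l)) / \<bar>t\<bar> powr (1 / real l)" for \<delta> t
  have W: "0 \<le> W \<delta> t" for \<delta> t by (simp add: W_def)
  have finK: "finite K" unfolding K_def using y0 by (rule finite_dyadic_between)
  have AB: "0 < y0 / 2" "y0 / 2 \<le> 2 * y1" using y0 y1 by auto
  note decay = scaled_oscillatory_decay[OF AB lam l g lower, where s = s, folded W_def]
  \<comment> \<open>The amplitude \<open>P (y / 2 powi k)\<close> depends on \<open>k\<close> but
    not on \<open>\<delta>\<close>, \<open>t\<close> or \<open>x\<close>, so each of the finitely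
    many \<open>k\<close> gets its own constant.\<close>
  have "\<exists>C\<ge>0. \<forall>\<delta>>0. \<forall>t x. t \<noteq> 0 \<longrightarrow> cmod (osc_I P g s \<delta> t x k) \<le> C * W \<delta> t" if k: "k \<in> K" for k
  proof -
    define c :: real where "c = 2 powi k"
    show ?thesis
      unfolding osc_I_def
    proof (rule decay[where b = "\<lambda>y. P (y / 2 powi k)"
          and b' = "\<lambda>x. (1 / 2 powi k) *\<^sub>R nth_deriv 1 P (x / 2 powi k)"], fold c_def)
      have sm: "smooth P" using P by (simp add: annular_cutoff_def)
      have c: "0 < c" "y0 \<le> c" "c \<le> y1" using k by (auto simp: c_def K_def)
      show "((\<lambda>y. P (y / c)) has_vector_derivative (1 / c) *\<^sub>R nth_deriv 1 P (x / c)) (at x)" for x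
      proof -
        have "((\<lambda>y. y / c) has_vector_derivative 1 / c) (at x)"
          using c by (auto intro!: derivative_eq_intros simp: has_real_derivative_iff_has_vector_derivative[symmetric])
        from vector_diff_chain_at[OF this smooth_C1(1)[OF sm]] show ?thesis
          by (simp add: o_def)
      qed
      show "continuous_on UNIV (\<lambda>x. (1 / c) *\<^sub>R nth_deriv 1 P (x / c))"
        using c by (intro continuous_intros continuous_on_compose2[OF smooth_C1(2)[OF sm]]) auto
      fix y :: real assume y: "0 < y" "P (y / c) \<noteq> 0"
      then have "1/2 \<le> y / c" "y / c \<le> 2"
        using annular_cutoff_nonzero[OF P y(2)] c by (simp_all add: c_def)
      then have "c / 2 \<le> y" "y \<le> 2 * c" using c by (simp_all add: field_simps)
      then show "y \<in> {y0 / 2..2 * y1}" using c by simp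
    qed
  qed
  then obtain CI where CI: "\<And>k. k \<in> K \<Longrightarrow> 0 \<le> CI k"
    and boundI: "\<And>k \<delta> t x. k \<in> K \<Longrightarrow> 0 < \<delta> \<Longrightarrow> t \<noteq> 0 \<Longrightarrow> cmod (osc_I P g s \<delta> t x k) \<le> CI k * W \<delta> t"
    by metis
  \<comment> \<open>The finite sum of the dyadic pieces is treated as one amplitude. Where it is
    nonzero, some summand is, which places positive \<open>y\<close> between \<open>y0 / 2\<close>
    and \<open>2 * y1\<close>.\<close>
  define q where "q y = (\<Sum>k\<in>K. lp_Q \<phi>0 k y)" for y
  obtain q' where dq: "\<And>k y. (lp_Q \<phi>0 k has_real_derivative q' k y) (at y)"
    and cq': "\<And>k. continuous_on UNIV (q' k)"
    using lp_Q_C1[OF \<phi>0] by metis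
  have even: "q (- y) = q y" for y
    using \<phi>0 by (simp add: q_def lp_Q_def lp_generator_def even_fun_def)
  have "\<exists>C\<ge>0. \<forall>\<delta>>0. \<forall>t x. t \<noteq> 0 \<longrightarrow>
    cmod (LINT \<xi>:{0<..}|lborel. exp (\<i> * of_real (x * \<xi>)) * exp (\<i> * of_real (t / \<delta> * g (\<delta> * \<xi>)))
        * of_real (q (\<delta> * \<xi>)) * of_real (\<xi> powr s)) \<le> C * W \<delta> t"
  proof (rule decay[where b = "\<lambda>y. of_real (q y)" and b' = "\<lambda>x. of_real (\<Sum>k\<in>K. q' k x)"])
    show "((\<lambda>y. complex_of_real (q y)) has_vector_derivative of_real (\<Sum>k\<in>K. q' k x)) (at x)" for x
      unfolding q_def by (intro has_vector_derivative_of_real DERIV_sum dq)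
    show "continuous_on UNIV (\<lambda>x. complex_of_real (\<Sum>k\<in>K. q' k x))"
      by (intro continuous_intros cq')
    fix y :: real assume y: "0 < y" "complex_of_real (q y) \<noteq> 0"
    then obtain k where k: "k \<in> K" "lp_Q \<phi>0 k y \<noteq> 0"
      unfolding q_def by (metis of_real_0 sum.neutral)
    then show "y \<in> {y0 / 2..2 * y1}"
      using lp_Q_nonzero[OF \<phi>0 y(1) k(2)] by (simp add: K_def)
  qed
  then obtain CJ where CJ: "0 \<le> CJ" and boundJ: "\<And>\<delta> t x. 0 < \<delta> \<Longrightarrow> t \<noteq> 0 \<Longrightarrow>
    cmod (LINT \<xi>:{0<..}|lborel. exp (\<i> * of_real (x * \<xi>)) * exp (\<i> * of_real (t / \<delta> * g (\<delta> * \<xi>)))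
        * of_real (q (\<delta> * \<xi>)) * of_real (\<xi> powr s)) \<le> CJ * W \<delta> t"
    by blast
  have J: "cmod (osc_J \<phi>0 g s y0 y1 \<delta> t x) \<le> 2 * CJ * W \<delta> t" if \<delta>: "0 < \<delta>" and t: "t \<noteq> 0" for \<delta> t x
  proof -
    \<comment> \<open>Since \<open>q\<close> is even, reflecting the negative half-line only
      replaces \<open>x\<close> by \<open>- x\<close>, and the bound is uniform in \<open>x\<close>.
      The integrand vanishes at the origin because \<open>0 powr s = 0\<close> for every
      \<open>s\<close>.\<close>
    have "cmod (osc_J \<phi>0 g s y0 y1 \<delta> t x) \<le>
      cmod (LINT \<xi>:{0<..}|lborel. exp (\<i> * of_real (x * \<xi>)) * exp (\<i> * of_real (t / \<delta> * g (\<delta> * \<xi>)))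
        * of_real (q (\<delta> * \<xi>)) * of_real (\<xi> powr s)) +
      cmod (LINT \<xi>:{0<..}|lborel. exp (\<i> * of_real (- x * \<xi>)) * exp (\<i> * of_real (t / \<delta> * g (\<delta> * \<xi>)))
        * of_real (q (\<delta> * \<xi>)) * of_real (\<xi> powr s))"
      unfolding osc_J_def K_def[symmetric] q_def[symmetric]
      by (rule norm_integral_le_half_lines) (simp_all add: even)
    also have "\<dots> \<le> CJ * W \<delta> t + CJ * W \<delta> t"
      by (intro add_mono boundJ \<delta> t)
    finally show ?thesis by simp
  qed
  \<comment> \<open>The sum dominates each \<open>CI k\<close>, the term \<open>2 * CJ\<close>
    covers the two half-lines, and the 1 ensures positivity even when no \<open>k\<close> is
    admissible.\<close>
  define C where "C = 1 + (\<Sum>k\<in>K. CI k) + 2 * CJ"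
  have sumC: "0 \<le> (\<Sum>k\<in>K. CI k)" using CI by (rule sum_nonneg)
  have "CI k \<le> C" if "k \<in> K" for k
    using member_le_sum[of k K CI] that CI finK CJ by (simp add: C_def)
  then have "cmod (osc_I P g s \<delta> t x k) \<le> C * W \<delta> t" if "k \<in> K" "0 < \<delta>" "t \<noteq> 0" for \<delta> t x k
    using boundI[OF that] W that(1) by (meson mult_right_mono order_trans)
  moreover have "cmod (osc_J \<phi>0 g s y0 y1 \<delta> t x) \<le> C * W \<delta> t" if "0 < \<delta>" "t \<noteq> 0" for \<delta> t x
    using J[OF that] by (rule order_trans) (use sumC in \<open>auto simp: C_def intro!: mult_right_mono W\<close>)
  moreover have "0 < C" using sumC CJ by (simp add: C_def)
  ultimately show ?thesis
    unfolding W_def[symmetric] K_def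
    by (intro exI[of _ C]) (auto intro!: SUP_least)
qed

end
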